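(* The following hold. <br> (1) For $d=3$ or $d=4$, $\Gamma_d(2)$ is generated by $e_{21}^d$ and $e_{21}^me_{12}^de_{21}^{-m}$ for $0\leq m\leq d-1$. <br> (2) $\Gamma_5(2)$ is generated by $e_{21}^5$, $e_{21}^me_{12}^5e_{21}^{-m}$ and $e_{21}^me_{12}^{\pm 2}e_{21}^5e_{12}^{\mp 2}e_{21}^{-m}$ for $0\leq m\leq 4$. <br> (3) $\Gamma_6(2)$ is generated by $e_{21}^6$, $e_{21}^me_{12}^6e_{21}^{-m}$ and $e_{21}^m[e_{21}^{\pm 3},e_{12}^{\pm 2}]e_{21}^{-m}$ for $0\leq m\leq 5$, where the two signs are taken equal.
   Context: $\Gamma_d(2)=\{X\in \mathrm{SL}(2;\mathbb{Z}) \mid X\equiv I \pmod d\}$. $e_{12}=\begin{pmatrix}1&1\\0&1\end{pmatrix}$ and $e_{21}=\begin{pmatrix}1&0\\1&1\end{pmatrix}$. Commutators are $[x,y]=xyx^{-1}y^{-1}$. *)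

theory Defs
  imports "HOL-Analysis.Analysis" "HOL-Algebra.Generated_Groups" "HOL-Number_Theory.Cong"
begin

definition SL2Z :: "(int ^ 2 ^ 2) monoid" where
  "SL2Z = \<lparr>carrier = {A. det A = 1}, mult = (**), one = mat 1\<rparr>"

definition Gamma2 :: "int \<Rightarrow> (int ^ 2 ^ 2) set" where
  "Gamma2 d = {X \<in> carrier SL2Z. \<forall>i j. [X $ i $ j = mat 1 $ i $ j] (mod d)}"

definition e12 :: "int ^ 2 ^ 2" where
  "e12 = vector [vector [1, 1], vector [0, 1]]"

definition e21 :: "int ^ 2 ^ 2" where
  "e21 = vector [vector [1, 0], vector [1, 1]]"

definition commutator :: "('a, 'b) monoid_scheme \<Rightarrow> 'a \<Rightarrow> 'a \<Rightarrow> 'a" where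
  "commutator G x y = x \<otimes>\<^bsub>G\<^esub> y \<otimes>\<^bsub>G\<^esub> inv\<^bsub>G\<^esub> x \<otimes>\<^bsub>G\<^esub> inv\<^bsub>G\<^esub> y"

text \<open>Inverses and integer powers are only meaningful in a group, hence the following facts.\<close>

lemma group_SL2Z: "group SL2Z"
proof (rule groupI)
  fix A assume "A \<in> carrier SL2Z"
  then have A: "det A = 1" by (simp add: SL2Z_def)
  define B :: "int ^ 2 ^ 2" where
    "B = vector [vector [A $ 2 $ 2, - A $ 1 $ 2], vector [- A $ 2 $ 1, A $ 1 $ 1]]"
  have "det B = 1" using A by (simp add: B_def det_2 algebra_simps)
  moreover have "B ** A = mat 1"
    using A by (simp add: B_def det_2 vec_eq_iff forall_2 matrix_matrix_mult_def sum_2 mat_def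
        algebra_simps)
  ultimately show "\<exists>B \<in> carrier SL2Z. B \<otimes>\<^bsub>SL2Z\<^esub> A = \<one>\<^bsub>SL2Z\<^esub>"
    by (auto simp: SL2Z_def)
qed (auto simp: SL2Z_def det_mul matrix_mul_assoc)

lemma e12_in_SL2Z: "e12 \<in> carrier SL2Z" and e21_in_SL2Z: "e21 \<in> carrier SL2Z"
  by (simp_all add: SL2Z_def e12_def e21_def det_2)

end

theory Submission
  imports Defs
begin

text \<open>
  Each of the three generating sets consists of \<open>e21\<^sup>d\<close> and the conjugates
  \<open>e21\<^sup>m s e21\<^sup>-\<^sup>m\<close>, \<open>0 \<le> m < d\<close>, of the elements \<open>s\<close> of a small set \<open>S\<close> that contains
  \<open>e12\<^sup>d\<close>. The subgroup \<open>H\<close> generated in this way is normalised by \<open>e21\<close>, so the group \<open>K\<close>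
  generated by \<open>e21\<close> and \<open>S\<close> is the product of \<open>H\<close> and the powers of \<open>e21\<close>
  (\<open>generate_insert_decompose\<close>). A power of \<open>e21\<close> lies in the congruence subgroup only if it is a
  power of \<open>e21\<^sup>d\<close>, hence only if it lies in \<open>H\<close>. It therefore suffices that \<open>K\<close> contains the
  principal congruence subgroup, and in fact \<open>K\<close> is the larger group of all matrices whose first
  row is \<open>(1, 0)\<close> modulo \<open>d\<close> (\<open>Gamma_row_descent\<close>).

  Membership in this larger group depends on the first row \<open>(a, b)\<close> alone, and the proof is a Euclidean descent
  on \<open>\<bar>a\<bar>\<close> by right multiplication. Powers of \<open>e12\<^sup>d\<close> leave \<open>a\<close> unchanged and move the ratio
  \<open>x = b / a\<close> into \<open>[- d / 2, d / 2]\<close>. If \<open>b = 0\<close>, then \<open>a = 1\<close> and the matrix is a power of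
  \<open>e21\<close>. If \<open>0 < \<bar>x\<bar> < 2\<close>, then \<open>e21\<close> or its inverse replaces \<open>a\<close> by \<open>a \<plusminus> b\<close>, which is
  smaller. The value \<open>\<bar>x\<bar> = 2\<close> is excluded by coprimality of \<open>a\<close> and \<open>b\<close>. For \<open>d = 3\<close> and
  \<open>d = 4\<close> nothing is left. For \<open>d = 5\<close> and \<open>d = 6\<close> there remains the gap
  \<open>2 < \<bar>x\<bar> \<le> d / 2\<close>, and the additional generators serve to close it: a matrix with first column
  \<open>(p, q)\<close> replaces \<open>a\<close> by \<open>a (p + q x)\<close>, and they provide the columns \<open>(- 9, \<plusminus> 4)\<close> for
  \<open>d = 5\<close>, which decrease \<open>\<bar>a\<bar>\<close> for \<open>2 < \<bar>x\<bar> < 5 / 2\<close>, and \<open>(- 5, \<plusminus> 2)\<close> for \<open>d = 6\<close>, which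
  decrease it for \<open>2 < \<bar>x\<bar> < 3\<close>. The endpoint \<open>\<bar>x\<bar> = d / 2\<close> does not occur.
\<close>

section \<open>Generators of a subgroup normalised by a cyclic group\<close>

text \<open>
  Moving every \<open>t\<close> in a word to the right leaves conjugates of elements of \<open>S\<close> by powers of \<open>t\<close>. The invariant of the
  induction is quantified over all \<open>m\<close>: it is preserved by products
  because the trailing power of \<open>t\<close> from the first factor only shifts the \<open>m\<close> used for the second.
\<close>

lemma (in group) generate_insert_decompose:
  assumes t: "t \<in> carrier G" and S: "S \<subseteq> carrier G" and d: "d > 0"
    and x: "x \<in> generate G (insert t S)"
  defines "H \<equiv> generate G ({t [^] d} \<union>
      {t [^] m \<otimes> s \<otimes> t [^] (- m) | (m :: int) s. 0 \<le> m \<and> m \<le> d - 1 \<and> s \<in> S})"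
  shows "\<exists>h \<in> H. \<exists>k :: int. x = h \<otimes> t [^] k"
proof -
  have gens: "{t [^] d} \<union> {t [^] m \<otimes> s \<otimes> t [^] (- m) | (m :: int) s. 0 \<le> m \<and> m \<le> d - 1 \<and> s \<in> S}
      \<subseteq> carrier G"
    using t S by auto
  interpret H: subgroup H G
    unfolding H_def by (rule generate_is_subgroup[OF gens])
  have td: "t [^] (d * q) \<in> H" for q :: int
  proof -
    have "t [^] d \<in> H" unfolding H_def by (rule generate.incl) simp
    then have "(t [^] d) [^] q \<in> H" using subgroup_int_pow_closed[OF H.subgroup_axioms] by blast
    then show ?thesis using t by (simp add: int_pow_pow mult.commute)
  qed
  have conj: "t [^] m \<otimes> s \<otimes> t [^] (- m) \<in> H" if s: "s \<in> S" for s and m :: int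
  proof -
    have sc: "s \<in> carrier G" using S s by blast
    \<comment> \<open>Conjugation by \<open>t\<^sup>d \<in> H\<close> reduces the exponent to its residue modulo \<open>d\<close>.\<close>
    let ?q = "m div d" and ?r = "m mod d"
    have "t [^] ?r \<otimes> s \<otimes> t [^] (- ?r) \<in> H"
      unfolding H_def by (rule generate.incl) (use s d in \<open>auto intro!: exI[of _ "m mod d"]\<close>)
    then have "t [^] (d * ?q) \<otimes> (t [^] ?r \<otimes> s \<otimes> t [^] (- ?r)) \<otimes> t [^] (d * (- ?q)) \<in> H"
      using td by blast
    also have "t [^] (d * ?q) \<otimes> (t [^] ?r \<otimes> s \<otimes> t [^] (- ?r)) \<otimes> t [^] (d * (- ?q))
        = (t [^] (d * ?q) \<otimes> t [^] ?r) \<otimes> s \<otimes> (t [^] (- ?r) \<otimes> t [^] (d * (- ?q)))"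
      using t sc by (simp add: m_assoc)
    also have "\<dots> = t [^] (d * ?q + ?r) \<otimes> s \<otimes> t [^] (- ?r + d * (- ?q))"
      using t by (simp only: int_pow_mult)
    also have "d * ?q + ?r = m" by simp
    also have "- ?r + d * (- ?q) = - m" by (simp add: minus_div_mult_eq_mod[symmetric])
    finally show ?thesis .
  qed
  \<comment> \<open>The number \<open>k\<close> is the total exponent of \<open>t\<close> in a word for \<open>x\<close>.\<close>
  have "\<exists>k :: int. \<forall>m :: int. t [^] m \<otimes> x \<otimes> t [^] (- (m + k)) \<in> H"
    using x
  proof (induction x rule: generate.induct)
    case one
    show ?case using t by (intro exI[of _ 0]) (simp add: int_pow_mult[symmetric])
  next
    case (incl h)
    show ?case
    proof (cases "h \<in> S")
      case True
      then show ?thesis using conj by (intro exI[of _ 0]) simp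
    next
      case False
      then have [simp]: "h = t" using incl by simp
      have "t [^] m \<otimes> t \<otimes> t [^] (- (m + 1)) = \<one>" for m :: int
      proof -
        have "t [^] m \<otimes> t [^] (1 :: int) \<otimes> t [^] (- (m + 1)) = t [^] (m + 1 + (- (m + 1)))"
          using t by (simp only: int_pow_mult)
        then show ?thesis using t by (simp add: int_pow_1)
      qed
      then show ?thesis by (intro exI[of _ 1]) (metis H.one_closed \<open>h = t\<close>)
    qed
  next
    case (inv h)
    show ?case
    proof (cases "h \<in> S")
      case True
      then have hc: "h \<in> carrier G" using S by blast
      have "t [^] m \<otimes> inv h \<otimes> t [^] (- m) = inv (t [^] m \<otimes> h \<otimes> t [^] (- m))" for m :: int
        using t hc by (simp add: inv_mult_group int_pow_neg m_assoc)
      then show ?thesis using conj[OF True] by (intro exI[of _ 0]) auto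
    next
      case False
      then have [simp]: "h = t" using inv by simp
      have "t [^] m \<otimes> inv t \<otimes> t [^] (- (m + - 1)) = \<one>" for m :: int
      proof -
        have "t [^] m \<otimes> t [^] (- 1 :: int) \<otimes> t [^] (- (m + - 1)) = t [^] (m + - 1 + (- (m + - 1)))"
          using t by (simp only: int_pow_mult)
        then show ?thesis using t by (simp add: int_pow_neg int_pow_1)
      qed
      then show ?thesis by (intro exI[of _ "- 1"]) (metis H.one_closed \<open>h = t\<close>)
    qed
  next
    case (eng x y)
    then obtain k l :: int
      where k: "\<And>m. t [^] m \<otimes> x \<otimes> t [^] (- (m + k)) \<in> H"
        and l: "\<And>m. t [^] m \<otimes> y \<otimes> t [^] (- (m + l)) \<in> H" by blast
    have xy: "x \<in> carrier G" "y \<in> carrier G"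
      using eng.hyps t S generate_in_carrier[of "insert t S"] by auto
    have "t [^] m \<otimes> (x \<otimes> y) \<otimes> t [^] (- (m + (k + l))) \<in> H" for m
    proof -
      have "(t [^] m \<otimes> x \<otimes> t [^] (- (m + k))) \<otimes> (t [^] (m + k) \<otimes> y \<otimes> t [^] (- (m + k + l)))
          = t [^] m \<otimes> x \<otimes> (t [^] (- (m + k)) \<otimes> t [^] (m + k)) \<otimes> y \<otimes> t [^] (- (m + k + l))"
        using t xy by (simp add: m_assoc)
      also have "t [^] (- (m + k)) \<otimes> t [^] (m + k) = \<one>"
        using t by (simp only: int_pow_mult[symmetric]) simp
      finally have "(t [^] m \<otimes> x \<otimes> t [^] (- (m + k))) \<otimes> (t [^] (m + k) \<otimes> y \<otimes> t [^] (- (m + k + l)))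
          = t [^] m \<otimes> (x \<otimes> y) \<otimes> t [^] (- (m + (k + l)))"
        using t xy by (simp add: m_assoc add.assoc)
      then show ?thesis using H.m_closed[OF k[of m] l[of "m + k"]] by simp
    qed
    then show ?case by blast
  qed
  then obtain k :: int where "t [^] (0 :: int) \<otimes> x \<otimes> t [^] (- (0 + k)) \<in> H" by blast
  moreover have xc: "x \<in> carrier G"
    using x t S generate_in_carrier[of "insert t S"] by auto
  ultimately have "x \<otimes> t [^] (- k) \<in> H" by simp
  moreover have "x = (x \<otimes> t [^] (- k)) \<otimes> t [^] k"
    using t xc by (simp add: m_assoc int_pow_mult[symmetric])
  ultimately show ?thesis by blast
qed

section \<open>Entries of matrices in SL(2, Z)\<close>

interpretation SL2Z: group SL2Z
  by (rule group_SL2Z)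

lemma mult_entry: "(A \<otimes>\<^bsub>SL2Z\<^esub> B) $ i $ j = A $ i $ 1 * B $ 1 $ j + A $ i $ 2 * B $ 2 $ j"
  by (simp add: SL2Z_def matrix_matrix_mult_def sum_2)

lemma one_entry: "\<one>\<^bsub>SL2Z\<^esub> $ i $ j = (if i = j then 1 else 0)"
  by (simp add: SL2Z_def mat_def)

lemma in_SL2Z_iff: "A \<in> carrier SL2Z \<longleftrightarrow> A $ 1 $ 1 * A $ 2 $ 2 - A $ 1 $ 2 * A $ 2 $ 1 = 1"
  by (simp add: SL2Z_def det_2)

lemma eq_iff_entries:
  "(A :: int ^ 2 ^ 2) = B \<longleftrightarrow> A $ 1 $ 1 = B $ 1 $ 1 \<and> A $ 1 $ 2 = B $ 1 $ 2
      \<and> A $ 2 $ 1 = B $ 2 $ 1 \<and> A $ 2 $ 2 = B $ 2 $ 2"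
  by (auto simp: vec_eq_iff forall_2)

lemma inv_eq:
  assumes "A \<in> carrier SL2Z"
  shows "inv\<^bsub>SL2Z\<^esub> A = vector [vector [A $ 2 $ 2, - A $ 1 $ 2], vector [- A $ 2 $ 1, A $ 1 $ 1]]"
  by (rule SL2Z.inv_equality)
    (use assms in \<open>auto simp: in_SL2Z_iff eq_iff_entries mult_entry one_entry algebra_simps\<close>)

lemma e12_pow: "e12 [^]\<^bsub>SL2Z\<^esub> (k :: int) = vector [vector [1, k], vector [0, 1]]"
proof (induction k rule: int_induct[of _ 0])
  case base
  show ?case by (simp add: eq_iff_entries one_entry)
next
  case (step1 i)
  have pow_Suc: "e12 [^]\<^bsub>SL2Z\<^esub> (i + 1) = e12 [^]\<^bsub>SL2Z\<^esub> i \<otimes>\<^bsub>SL2Z\<^esub> e12"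
    using e12_in_SL2Z by (simp add: SL2Z.int_pow_mult SL2Z.int_pow_1)
  show ?case unfolding pow_Suc step1.IH by (simp add: eq_iff_entries mult_entry e12_def)
next
  case (step2 i)
  have pow_pred: "e12 [^]\<^bsub>SL2Z\<^esub> (i - 1) = e12 [^]\<^bsub>SL2Z\<^esub> i \<otimes>\<^bsub>SL2Z\<^esub> inv\<^bsub>SL2Z\<^esub> e12"
    using e12_in_SL2Z by (simp add: SL2Z.int_pow_diff SL2Z.int_pow_1)
  show ?case unfolding pow_pred step2.IH inv_eq[OF e12_in_SL2Z]
    by (simp add: eq_iff_entries mult_entry e12_def)
qed

lemma e21_pow: "e21 [^]\<^bsub>SL2Z\<^esub> (k :: int) = vector [vector [1, 0], vector [k, 1]]"
proof (induction k rule: int_induct[of _ 0])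
  case base
  show ?case by (simp add: eq_iff_entries one_entry)
next
  case (step1 i)
  have pow_Suc: "e21 [^]\<^bsub>SL2Z\<^esub> (i + 1) = e21 [^]\<^bsub>SL2Z\<^esub> i \<otimes>\<^bsub>SL2Z\<^esub> e21"
    using e21_in_SL2Z by (simp add: SL2Z.int_pow_mult SL2Z.int_pow_1)
  show ?case unfolding pow_Suc step1.IH by (simp add: eq_iff_entries mult_entry e21_def)
next
  case (step2 i)
  have pow_pred: "e21 [^]\<^bsub>SL2Z\<^esub> (i - 1) = e21 [^]\<^bsub>SL2Z\<^esub> i \<otimes>\<^bsub>SL2Z\<^esub> inv\<^bsub>SL2Z\<^esub> e21"
    using e21_in_SL2Z by (simp add: SL2Z.int_pow_diff SL2Z.int_pow_1)
  show ?case unfolding pow_pred step2.IH inv_eq[OF e21_in_SL2Z]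
    by (simp add: eq_iff_entries mult_entry e21_def)
qed

section \<open>Congruence subgroups\<close>

lemma in_Gamma2_iff:
  "A \<in> Gamma2 d \<longleftrightarrow> A \<in> carrier SL2Z \<and> d dvd A $ 1 $ 1 - 1 \<and> d dvd A $ 1 $ 2
      \<and> d dvd A $ 2 $ 1 \<and> d dvd A $ 2 $ 2 - 1"
  by (auto simp: Gamma2_def cong_iff_dvd_diff forall_2 mat_def)

text \<open>
  The transpose of the classical congruence subgroup \<open>\<Gamma>\<^sub>1(d)\<close>. It is the product of the principal congruence subgroup and the powers of \<open>e21\<close>.
\<close>

definition Gamma_row :: "int \<Rightarrow> (int ^ 2 ^ 2) set" where
  "Gamma_row d = {A \<in> carrier SL2Z. d dvd A $ 1 $ 1 - 1 \<and> d dvd A $ 1 $ 2}"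

lemma subgroup_Gamma_row: "subgroup (Gamma_row d) SL2Z"
proof (rule SL2Z.subgroupI)
  show "Gamma_row d \<subseteq> carrier SL2Z" by (auto simp: Gamma_row_def)
  have "\<one>\<^bsub>SL2Z\<^esub> \<in> Gamma_row d" by (simp add: Gamma_row_def one_entry)
  then show "Gamma_row d \<noteq> {}" by blast
next
  fix A assume "A \<in> Gamma_row d"
  then have A: "A \<in> carrier SL2Z" and 1: "d dvd A $ 1 $ 1 - 1" and 2: "d dvd A $ 1 $ 2"
    by (auto simp: Gamma_row_def)
  have "A $ 2 $ 2 - 1 = A $ 1 $ 2 * A $ 2 $ 1 - (A $ 1 $ 1 - 1) * A $ 2 $ 2"
    using A by (simp add: in_SL2Z_iff algebra_simps)
  then have "d dvd A $ 2 $ 2 - 1" using 1 2 by simp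
  then show "inv\<^bsub>SL2Z\<^esub> A \<in> Gamma_row d"
    using A 2 by (simp add: Gamma_row_def) (simp add: inv_eq)
next
  fix A B assume AB: "A \<in> Gamma_row d" "B \<in> Gamma_row d"
  have eq: "(A \<otimes>\<^bsub>SL2Z\<^esub> B) $ 1 $ 1 - 1
      = (A $ 1 $ 1 - 1) * B $ 1 $ 1 + (B $ 1 $ 1 - 1) + A $ 1 $ 2 * B $ 2 $ 1"
    by (simp add: mult_entry algebra_simps)
  have "d dvd (A \<otimes>\<^bsub>SL2Z\<^esub> B) $ 1 $ 1 - 1"
    unfolding eq using AB by (intro dvd_add dvd_mult2) (auto simp: Gamma_row_def)
  moreover have "d dvd (A \<otimes>\<^bsub>SL2Z\<^esub> B) $ 1 $ 2"
    using AB by (simp add: Gamma_row_def mult_entry)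
  ultimately show "A \<otimes>\<^bsub>SL2Z\<^esub> B \<in> Gamma_row d"
    using AB by (simp add: Gamma_row_def)
qed

lemma subgroup_Gamma2: "subgroup (Gamma2 d) SL2Z"
proof (rule SL2Z.subgroupI)
  show "Gamma2 d \<subseteq> carrier SL2Z" by (auto simp: in_Gamma2_iff)
  have "\<one>\<^bsub>SL2Z\<^esub> \<in> Gamma2 d" by (simp add: in_Gamma2_iff one_entry)
  then show "Gamma2 d \<noteq> {}" by blast
next
  fix A assume "A \<in> Gamma2 d"
  then show "inv\<^bsub>SL2Z\<^esub> A \<in> Gamma2 d"
    by (simp add: in_Gamma2_iff) (simp add: inv_eq)
next
  fix A B assume AB: "A \<in> Gamma2 d" "B \<in> Gamma2 d"
  have eq: "(A \<otimes>\<^bsub>SL2Z\<^esub> B) $ 1 $ 1 - 1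
      = (A $ 1 $ 1 - 1) * B $ 1 $ 1 + (B $ 1 $ 1 - 1) + A $ 1 $ 2 * B $ 2 $ 1"
    "(A \<otimes>\<^bsub>SL2Z\<^esub> B) $ 2 $ 2 - 1
      = (A $ 2 $ 2 - 1) * B $ 2 $ 2 + (B $ 2 $ 2 - 1) + A $ 2 $ 1 * B $ 1 $ 2"
    by (simp_all add: mult_entry algebra_simps)
  have "d dvd (A \<otimes>\<^bsub>SL2Z\<^esub> B) $ 1 $ 1 - 1" "d dvd (A \<otimes>\<^bsub>SL2Z\<^esub> B) $ 2 $ 2 - 1"
    unfolding eq using AB by (intro dvd_add dvd_mult2; simp add: in_Gamma2_iff)+
  moreover have "d dvd (A \<otimes>\<^bsub>SL2Z\<^esub> B) $ 1 $ 2" "d dvd (A \<otimes>\<^bsub>SL2Z\<^esub> B) $ 2 $ 1"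
    using AB by (simp_all add: in_Gamma2_iff mult_entry)
  ultimately show "A \<otimes>\<^bsub>SL2Z\<^esub> B \<in> Gamma2 d"
    using AB by (simp add: in_Gamma2_iff)
qed

text \<open>
  Writing \<open>A = 1 + d N\<close>, the conjugate is \<open>1 + d (T N T\<^sup>-\<^sup>1)\<close>; the proof spells out the entries.
\<close>

lemma Gamma2_conj:
  assumes A: "A \<in> Gamma2 d" and T: "T \<in> carrier SL2Z"
  shows "T \<otimes>\<^bsub>SL2Z\<^esub> A \<otimes>\<^bsub>SL2Z\<^esub> inv\<^bsub>SL2Z\<^esub> T \<in> Gamma2 d"
proof -
  have Ac: "A \<in> carrier SL2Z" using A by (simp add: in_Gamma2_iff)
  obtain p q r u where A': "A $ 1 $ 1 = 1 + d * p" "A $ 1 $ 2 = d * q" "A $ 2 $ 1 = d * r"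
      "A $ 2 $ 2 = 1 + d * u"
    using A unfolding in_Gamma2_iff dvd_def by (metis add.commute diff_add_cancel)
  define x y z w where xyzw: "x = T $ 1 $ 1" "y = T $ 1 $ 2" "z = T $ 2 $ 1" "w = T $ 2 $ 2"
  have det: "x * w = 1 + y * z" using T by (simp add: in_SL2Z_iff xyzw)
  have e: "(x * (1 + d * p) + y * (d * r)) * w - (x * (d * q) + y * (1 + d * u)) * z - 1
        = d * ((x * p + y * r) * w - (x * q + y * u) * z)"
    "(x * (d * q) + y * (1 + d * u)) * x - (x * (1 + d * p) + y * (d * r)) * y
        = d * ((x * q + y * u) * x - (x * p + y * r) * y)"
    "(z * (1 + d * p) + w * (d * r)) * w - (z * (d * q) + w * (1 + d * u)) * z
        = d * ((z * p + w * r) * w - (z * q + w * u) * z)"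
    "(z * (d * q) + w * (1 + d * u)) * x - (z * (1 + d * p) + w * (d * r)) * y - 1
        = d * ((z * q + w * u) * x - (z * p + w * r) * y)"
    using det by algebra+
  have "T \<otimes>\<^bsub>SL2Z\<^esub> A \<otimes>\<^bsub>SL2Z\<^esub> inv\<^bsub>SL2Z\<^esub> T \<in> carrier SL2Z" using T Ac by simp
  then show ?thesis
    unfolding in_Gamma2_iff
    by (simp add: mult_entry inv_eq T A' xyzw[symmetric])
      (use e in \<open>metis dvd_triv_left\<close>)
qed

lemma Gamma2_subset_Gamma_row: "Gamma2 d \<subseteq> Gamma_row d"
  by (auto simp: in_Gamma2_iff Gamma_row_def)

lemma e21_pow_in_Gamma2_iff: "e21 [^]\<^bsub>SL2Z\<^esub> (k :: int) \<in> Gamma2 d \<longleftrightarrow> d dvd k"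
  by (simp add: in_Gamma2_iff in_SL2Z_iff e21_pow)

lemma e12_pow_in_Gamma2_iff: "e12 [^]\<^bsub>SL2Z\<^esub> (k :: int) \<in> Gamma2 d \<longleftrightarrow> d dvd k"
  by (simp add: in_Gamma2_iff in_SL2Z_iff e12_pow)

section \<open>Descent on the first row\<close>

lemma balanced_residue:
  assumes "(n :: int) > 0"
  obtains k where "2 * \<bar>b + n * k\<bar> \<le> n"
proof (cases "2 * (b mod n) \<le> n")
  case True
  have "b + n * (- (b div n)) = b mod n" by (simp add: minus_mult_div_eq_mod)
  then show thesis using True assms by (intro that[of "- (b div n)"]) simp
next
  case False
  have "b + n * (- (b div n) - 1) = b mod n - n"
    using minus_mult_div_eq_mod[of b n] by (simp add: algebra_simps)
  moreover have "2 * \<bar>r - n\<bar> \<le> n" if "\<not> 2 * r \<le> n" "r < n" for r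
    using that by simp
  then have "2 * \<bar>b mod n - n\<bar> \<le> n" using False pos_mod_bound[OF assms, of b] by blast
  ultimately show thesis by (intro that[of "- (b div n) - 1"]) simp
qed

text \<open>
  The hypothesis \<open>gap\<close> isolates the one range of the ratio \<open>b / a\<close> in which \<open>e21\<close> and
  \<open>e12\<^sup>d\<close> cannot decrease \<open>\<bar>a\<bar>\<close>. It is void for \<open>d \<le> 4\<close>.
\<close>

lemma Gamma_row_descent:
  fixes d :: int
  assumes K: "subgroup K SL2Z" and KG: "K \<subseteq> Gamma_row d" and d: "d \<ge> 3"
    and e21K: "e21 \<in> K" and e12K: "e12 [^]\<^bsub>SL2Z\<^esub> d \<in> K"
    and gap: "\<And>a b. \<lbrakk>coprime a b; d dvd a - 1; d dvd b; 2 * \<bar>a\<bar> < \<bar>b\<bar>; 2 * \<bar>b\<bar> \<le> d * \<bar>a\<bar>\<rbrakk>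
      \<Longrightarrow> \<exists>g \<in> K. \<bar>a * g $ 1 $ 1 + b * g $ 2 $ 1\<bar> < \<bar>a\<bar>"
  shows "X \<in> Gamma_row d \<Longrightarrow> X \<in> K"
proof (induction "nat \<bar>X $ 1 $ 1\<bar>" arbitrary: X rule: less_induct)
  case less
  interpret K: subgroup K SL2Z by (rule K)
  have cancel: "Y \<in> K" if "Y \<otimes>\<^bsub>SL2Z\<^esub> g \<in> K" "g \<in> K" "Y \<in> carrier SL2Z" for Y g
  proof -
    have "(Y \<otimes>\<^bsub>SL2Z\<^esub> g) \<otimes>\<^bsub>SL2Z\<^esub> inv\<^bsub>SL2Z\<^esub> g \<in> K" using that by blast
    then show ?thesis using that by (simp add: SL2Z.m_assoc)
  qed
  have e21k: "e21 [^]\<^bsub>SL2Z\<^esub> (k :: int) \<in> K" for k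
    using SL2Z.subgroup_int_pow_closed[OF K e21K] .
  have e12k: "e12 [^]\<^bsub>SL2Z\<^esub> (d * k) \<in> K" for k
    using SL2Z.subgroup_int_pow_closed[OF K e12K, of k] e12_in_SL2Z
    by (simp add: SL2Z.int_pow_pow)
  define a where "a = X $ 1 $ 1"
  have da: "d dvd a - 1" using less.prems by (simp add: Gamma_row_def a_def)
  have a0: "a \<noteq> 0"
  proof
    assume "a = 0"
    then have "d dvd 1" using da by simp
    then show False using d zdvd_imp_le[of d 1] by linarith
  qed
  have "d * \<bar>a\<bar> > 0" using a0 d by simp
  from balanced_residue[OF this, of "X $ 1 $ 2"]
  obtain k where k: "2 * \<bar>X $ 1 $ 2 + d * \<bar>a\<bar> * k\<bar> \<le> d * \<bar>a\<bar>" .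
  \<comment> \<open>The factor \<open>sgn a\<close> turns the step \<open>d \<bar>a\<bar> k\<close> into \<open>a\<close> times an exponent of \<open>e12\<close>.\<close>
  define g0 where "g0 = e12 [^]\<^bsub>SL2Z\<^esub> (d * (sgn a * k))"
  define Y where "Y = X \<otimes>\<^bsub>SL2Z\<^esub> g0"
  define b where "b = Y $ 1 $ 2"
  have g0K: "g0 \<in> K" unfolding g0_def by (rule e12k)
  have Xc: "X \<in> carrier SL2Z" using less.prems by (simp add: Gamma_row_def)
  have Ya: "Y $ 1 $ 1 = a" by (simp add: Y_def g0_def mult_entry e12_pow a_def)
  have "b = X $ 1 $ 2 + d * (a * sgn a) * k"
    by (simp add: b_def Y_def g0_def mult_entry e12_pow a_def[symmetric])
  then have "b = X $ 1 $ 2 + d * \<bar>a\<bar> * k" by (simp only: abs_sgn)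
  then have b: "2 * \<bar>b\<bar> \<le> d * \<bar>a\<bar>" using k by simp
  have YR: "Y \<in> Gamma_row d" unfolding Y_def
    using subgroup.m_closed[OF subgroup_Gamma_row less.prems] g0K KG by blast
  have Yc: "Y \<in> carrier SL2Z" using YR by (simp add: Gamma_row_def)
  have db: "d dvd b" using YR by (simp add: Gamma_row_def b_def)
  have detY: "a * Y $ 2 $ 2 - b * Y $ 2 $ 1 = 1"
    using Yc by (simp add: in_SL2Z_iff Ya b_def)
  \<comment> \<open>A unimodular row is coprime.\<close>
  have cop: "coprime a b"
  proof (rule coprimeI)
    fix c assume "c dvd a" "c dvd b"
    then have "c dvd a * Y $ 2 $ 2 - b * Y $ 2 $ 1" by simp
    then show "is_unit c" using detY by simp
  qed
  have step: "Y \<in> K" if g: "g \<in> K" and lt: "\<bar>a * g $ 1 $ 1 + b * g $ 2 $ 1\<bar> < \<bar>a\<bar>" for g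
  proof -
    have "(Y \<otimes>\<^bsub>SL2Z\<^esub> g) $ 1 $ 1 = a * g $ 1 $ 1 + b * g $ 2 $ 1"
      by (simp add: mult_entry Ya b_def)
    moreover have "Y \<otimes>\<^bsub>SL2Z\<^esub> g \<in> Gamma_row d"
      using subgroup.m_closed[OF subgroup_Gamma_row YR] g KG by blast
    ultimately have "Y \<otimes>\<^bsub>SL2Z\<^esub> g \<in> K" using less.hyps lt by (simp add: a_def)
    then show ?thesis using cancel g Yc by blast
  qed
  consider "b = 0" | "b \<noteq> 0" "\<bar>b\<bar> < 2 * \<bar>a\<bar>" | "\<bar>b\<bar> = 2 * \<bar>a\<bar>" | "2 * \<bar>a\<bar> < \<bar>b\<bar>" by linarith
  then have "Y \<in> K"
  proof cases
    case 1
    then have au: "a * Y $ 2 $ 2 = 1" using detY by simp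
    then have "a = 1 \<or> a = - 1" by (auto simp: zmult_eq_1_iff)
    moreover have "a \<noteq> - 1"
    proof
      assume "a = - 1"
      then have "d dvd 2" using da by simp
      then show False using d zdvd_imp_le[of d 2] by linarith
    qed
    ultimately have "a = 1" by blast
    then have "Y = e21 [^]\<^bsub>SL2Z\<^esub> (Y $ 2 $ 1)"
      using au 1 Ya by (simp add: eq_iff_entries e21_pow b_def)
    then show ?thesis using e21k by metis
  next
    case 2
    \<comment> \<open>The sign makes \<open>b s\<close> opposite to \<open>a\<close>.\<close>
    define s where "s = - sgn (a * b)"
    have "\<bar>a + b * s\<bar> < \<bar>a\<bar>"
      using 2 a0 unfolding s_def by (cases "a > 0"; cases "b > 0") (auto simp: sgn_mult)
    then show ?thesis by (intro step[OF e21k[of s]]) (simp add: e21_pow)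
  next
    case 3
    \<comment> \<open>Coprimality leaves only \<open>\<bar>b\<bar> = 2\<close>, which is not a multiple of \<open>d \<ge> 3\<close>.\<close>
    then have "a dvd b" by (metis dvd_abs_iff dvd_triv_right abs_dvd_iff)
    then have "\<bar>a\<bar> = 1" using cop by (metis coprime_absorb_left zdvd1_eq)
    then have "\<bar>b\<bar> = 2" using 3 by simp
    moreover have "d dvd \<bar>b\<bar>" using db by simp
    ultimately show ?thesis using d zdvd_imp_le[of d 2] by simp
  next
    case 4
    then show ?thesis using gap[OF cop da db _ b] step by blast
  qed
  then show ?case using cancel g0K Xc unfolding Y_def by blast
qed

section \<open>Generators of the principal congruence subgroups\<close>

text \<open>
  The common form of the three cases: an explicit set \<open>S\<close> works as soon as it closes the gap of the
  descent.
\<close>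

lemma Gamma2_generators:
  fixes d :: int
  assumes d: "d \<ge> 3" and S: "S \<subseteq> Gamma2 d" and e12S: "e12 [^]\<^bsub>SL2Z\<^esub> d \<in> S"
    and gap: "\<And>a b. \<lbrakk>coprime a b; d dvd a - 1; d dvd b; 2 * \<bar>a\<bar> < \<bar>b\<bar>; 2 * \<bar>b\<bar> \<le> d * \<bar>a\<bar>\<rbrakk>
      \<Longrightarrow> \<exists>g \<in> generate SL2Z (insert e21 S). \<bar>a * g $ 1 $ 1 + b * g $ 2 $ 1\<bar> < \<bar>a\<bar>"
  shows "Gamma2 d = generate SL2Z ({e21 [^]\<^bsub>SL2Z\<^esub> d} \<union>
      {e21 [^]\<^bsub>SL2Z\<^esub> m \<otimes>\<^bsub>SL2Z\<^esub> s \<otimes>\<^bsub>SL2Z\<^esub> e21 [^]\<^bsub>SL2Z\<^esub> (- m) | (m :: int) s.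
        0 \<le> m \<and> m \<le> d - 1 \<and> s \<in> S})"
    (is "_ = generate SL2Z ?T")
proof
  have Sc: "S \<subseteq> carrier SL2Z" using S by (auto simp: in_Gamma2_iff)
  have "e21 [^]\<^bsub>SL2Z\<^esub> m \<otimes>\<^bsub>SL2Z\<^esub> s \<otimes>\<^bsub>SL2Z\<^esub> e21 [^]\<^bsub>SL2Z\<^esub> (- m) \<in> Gamma2 d" if "s \<in> S" for m :: int and s
    using Gamma2_conj[of s d "e21 [^]\<^bsub>SL2Z\<^esub> m"] S that e21_in_SL2Z
    by (auto simp: SL2Z.int_pow_neg)
  then have "?T \<subseteq> Gamma2 d" by (auto simp: e21_pow_in_Gamma2_iff)
  then show H: "generate SL2Z ?T \<subseteq> Gamma2 d"
    by (rule SL2Z.generate_subgroup_incl[OF _ subgroup_Gamma2])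
  have Tc: "?T \<subseteq> carrier SL2Z" using \<open>?T \<subseteq> Gamma2 d\<close> subgroup.subset[OF subgroup_Gamma2] by (rule subset_trans)
  interpret H: subgroup "generate SL2Z ?T" SL2Z by (rule SL2Z.generate_is_subgroup[OF Tc])
  let ?K = "generate SL2Z (insert e21 S)"
  have e21S: "insert e21 S \<subseteq> carrier SL2Z" using Sc e21_in_SL2Z by blast
  have "insert e21 S \<subseteq> Gamma_row d"
    using S Gamma2_subset_Gamma_row e21_in_SL2Z by (auto simp: Gamma_row_def) (simp_all add: e21_def)
  then have KR: "?K \<subseteq> Gamma_row d"
    by (rule SL2Z.generate_subgroup_incl[OF _ subgroup_Gamma_row])
  have RK: "X \<in> ?K" if "X \<in> Gamma_row d" for X
    by (rule Gamma_row_descent[OF SL2Z.generate_is_subgroup[OF e21S] KR d _ _ gap that])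
      (use e12S in \<open>auto intro: generate.incl\<close>)
  show "Gamma2 d \<subseteq> generate SL2Z ?T"
  proof
    fix X assume X: "X \<in> Gamma2 d"
    then have "X \<in> ?K" using RK Gamma2_subset_Gamma_row by blast
    then obtain h and k :: int where h: "h \<in> generate SL2Z ?T"
        and Xh: "X = h \<otimes>\<^bsub>SL2Z\<^esub> e21 [^]\<^bsub>SL2Z\<^esub> k"
      using SL2Z.generate_insert_decompose[OF e21_in_SL2Z Sc, of d X] d by auto
    \<comment> \<open>The remaining power of \<open>e21\<close> is itself in the congruence subgroup, so \<open>d\<close> divides \<open>k\<close>.\<close>
    have "inv\<^bsub>SL2Z\<^esub> h \<otimes>\<^bsub>SL2Z\<^esub> X = e21 [^]\<^bsub>SL2Z\<^esub> k"
      using h Xh e21_in_SL2Z by (simp add: SL2Z.m_assoc[symmetric])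
    moreover have "inv\<^bsub>SL2Z\<^esub> h \<otimes>\<^bsub>SL2Z\<^esub> X \<in> Gamma2 d"
      using subgroup.m_closed[OF subgroup_Gamma2 subgroup.m_inv_closed[OF subgroup_Gamma2] X] h H
      by blast
    ultimately have "d dvd k" by (simp add: e21_pow_in_Gamma2_iff)
    then obtain q where q: "k = d * q" by (rule dvdE)
    have "e21 [^]\<^bsub>SL2Z\<^esub> d \<in> generate SL2Z ?T" by (rule generate.incl) simp
    then have "(e21 [^]\<^bsub>SL2Z\<^esub> d) [^]\<^bsub>SL2Z\<^esub> q \<in> generate SL2Z ?T"
      by (rule SL2Z.subgroup_int_pow_closed[OF H.subgroup_axioms])
    then have "e21 [^]\<^bsub>SL2Z\<^esub> k \<in> generate SL2Z ?T"
      using e21_in_SL2Z by (simp add: q SL2Z.int_pow_pow mult.commute)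
    then show "X \<in> generate SL2Z ?T" using h Xh by blast
  qed
qed

lemma Gamma2_3_4:
  fixes d :: int
  assumes "d = 3 \<or> d = 4"
  shows "Gamma2 d = generate SL2Z
        ({e21 [^]\<^bsub>SL2Z\<^esub> d} \<union>
         {e21 [^]\<^bsub>SL2Z\<^esub> m \<otimes>\<^bsub>SL2Z\<^esub> e12 [^]\<^bsub>SL2Z\<^esub> d \<otimes>\<^bsub>SL2Z\<^esub> e21 [^]\<^bsub>SL2Z\<^esub> (- m)
           | m :: int. 0 \<le> m \<and> m \<le> d - 1})"
proof -
  have "Gamma2 d = generate SL2Z ({e21 [^]\<^bsub>SL2Z\<^esub> d} \<union>
      {e21 [^]\<^bsub>SL2Z\<^esub> m \<otimes>\<^bsub>SL2Z\<^esub> s \<otimes>\<^bsub>SL2Z\<^esub> e21 [^]\<^bsub>SL2Z\<^esub> (- m) | (m :: int) s.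
        0 \<le> m \<and> m \<le> d - 1 \<and> s \<in> {e12 [^]\<^bsub>SL2Z\<^esub> d}})"
    by (rule Gamma2_generators) (use assms in \<open>auto simp: e12_pow_in_Gamma2_iff\<close>)
  then show ?thesis by simp
qed

text \<open>
  The gap is \<open>2 < \<bar>b / a\<bar> \<le> 5 / 2\<close>. For positive ratio the element
  \<open>e21\<^sup>-\<^sup>1 (e12\<^sup>2 e21\<^sup>-\<^sup>5 e12\<^sup>-\<^sup>2)\<close> has first column \<open>(- 9, 4)\<close>, and
  \<open>\<bar>4 x - 9\<bar> < 1\<close> holds exactly for \<open>2 < x < 5 / 2\<close>. For negative ratio one changes the sign of all
  exponents; hence the sign \<open>s\<close> in the proof.
\<close>

lemma Gamma2_5:
  "Gamma2 5 = generate SL2Z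
        ({e21 [^]\<^bsub>SL2Z\<^esub> (5 :: int)} \<union>
         {e21 [^]\<^bsub>SL2Z\<^esub> m \<otimes>\<^bsub>SL2Z\<^esub> e12 [^]\<^bsub>SL2Z\<^esub> (5 :: int) \<otimes>\<^bsub>SL2Z\<^esub> e21 [^]\<^bsub>SL2Z\<^esub> (- m)
           | m :: int. 0 \<le> m \<and> m \<le> 4} \<union>
         {e21 [^]\<^bsub>SL2Z\<^esub> m \<otimes>\<^bsub>SL2Z\<^esub> e12 [^]\<^bsub>SL2Z\<^esub> (2 * s) \<otimes>\<^bsub>SL2Z\<^esub> e21 [^]\<^bsub>SL2Z\<^esub> (5 :: int)
             \<otimes>\<^bsub>SL2Z\<^esub> e12 [^]\<^bsub>SL2Z\<^esub> (- 2 * s) \<otimes>\<^bsub>SL2Z\<^esub> e21 [^]\<^bsub>SL2Z\<^esub> (- m)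
           | (m :: int) (s :: int). 0 \<le> m \<and> m \<le> 4 \<and> s \<in> {1, - 1}})"
    (is "_ = generate SL2Z ?T")
proof -
  define c where "c s = e12 [^]\<^bsub>SL2Z\<^esub> (2 * s) \<otimes>\<^bsub>SL2Z\<^esub> e21 [^]\<^bsub>SL2Z\<^esub> (5 :: int)
      \<otimes>\<^bsub>SL2Z\<^esub> e12 [^]\<^bsub>SL2Z\<^esub> (- 2 * s)" for s :: int
  define S where "S = insert (e12 [^]\<^bsub>SL2Z\<^esub> (5 :: int)) (c ` {1, - 1})"
  have cG: "c s \<in> Gamma2 5" for s
    using Gamma2_conj[of "e21 [^]\<^bsub>SL2Z\<^esub> (5 :: int)" 5 "e12 [^]\<^bsub>SL2Z\<^esub> (2 * s)"] e12_in_SL2Z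
    by (simp add: c_def e21_pow_in_Gamma2_iff SL2Z.int_pow_neg)
  have cc: "c s \<in> carrier SL2Z" for s using cG[of s] by (simp add: in_Gamma2_iff)
  have c_eq: "c s = vector [vector [1 + 10 * s, - 20 * s\<^sup>2], vector [5, 1 - 10 * s]]" for s
    by (simp add: c_def e12_pow e21_pow mult_entry eq_iff_entries algebra_simps power2_eq_square)
  have c_pow: "c s [^]\<^bsub>SL2Z\<^esub> (- s) = vector [vector [- 9, 20 * s], vector [- 5 * s, 11]]"
    if "s \<in> {1, - 1}" for s
  proof (cases "s = 1")
    case True
    have "c 1 [^]\<^bsub>SL2Z\<^esub> (- 1 :: int) = inv\<^bsub>SL2Z\<^esub> c 1"
      by (simp add: SL2Z.int_pow_neg cc)
    then show ?thesis using True by (simp add: inv_eq[OF cc]) (simp add: c_eq)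
  next
    case False
    then have "s = - 1" using that by simp
    then show ?thesis using cc by simp (simp add: c_eq)
  qed
  have SG: "S \<subseteq> Gamma2 5"
    using cG by (auto simp: S_def e12_pow_in_Gamma2_iff)
  then have Sc: "insert e21 S \<subseteq> carrier SL2Z" using e21_in_SL2Z by (auto simp: in_Gamma2_iff)
  interpret K: subgroup "generate SL2Z (insert e21 S)" SL2Z
    by (rule SL2Z.generate_is_subgroup[OF Sc])
  have "Gamma2 5 = generate SL2Z ({e21 [^]\<^bsub>SL2Z\<^esub> (5 :: int)} \<union>
      {e21 [^]\<^bsub>SL2Z\<^esub> m \<otimes>\<^bsub>SL2Z\<^esub> s \<otimes>\<^bsub>SL2Z\<^esub> e21 [^]\<^bsub>SL2Z\<^esub> (- m) | (m :: int) s.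
        0 \<le> m \<and> m \<le> 5 - 1 \<and> s \<in> S})"
  proof (rule Gamma2_generators)
    fix a b :: int
    assume ab: "coprime a b" "5 dvd a - 1" "5 dvd b" "2 * \<bar>a\<bar> < \<bar>b\<bar>" "2 * \<bar>b\<bar> \<le> 5 * \<bar>a\<bar>"
    \<comment> \<open>Ratio \<open>\<plusminus> 5 / 2\<close> in lowest terms forces \<open>a = \<plusminus> 2\<close>, which is not \<open>1\<close> modulo \<open>5\<close>.\<close>
    have ne: "2 * \<bar>b\<bar> \<noteq> 5 * \<bar>a\<bar>"
    proof
      assume eq: "2 * \<bar>b\<bar> = 5 * \<bar>a\<bar>"
      obtain b' where b': "b = 5 * b'" using ab(3) by (rule dvdE)
      then have a: "\<bar>a\<bar> = 2 * \<bar>b'\<bar>" using eq by simp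
      then have "b' dvd a" by (metis abs_dvd_iff dvd_abs_iff dvd_triv_right)
      then have "is_unit b'" using ab(1) b' by (meson coprime_common_divisor dvd_triv_right)
      then have "\<bar>a\<bar> = 2" using a by simp
      then have "a = 2 \<or> a = - 2" by linarith
      then show False using ab(2) by auto
    qed
    define s where "s = sgn (a * b)"
    have s: "s \<in> {1, - 1}" using ab unfolding s_def by (auto simp: sgn_if)
    have "\<exists>g \<in> generate SL2Z (insert e21 S). g $ 1 $ 1 = - 9 \<and> g $ 2 $ 1 = 4 * s"
    proof -
      have e: "e21 \<in> generate SL2Z (insert e21 S)" "c s \<in> generate SL2Z (insert e21 S)"
        using s by (auto simp: S_def intro: generate.incl)
      \<comment> \<open>The first column of \<open>c\<^sub>s\<^sup>-\<^sup>s\<close> is \<open>(- 9, - 5 s)\<close>; left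
        multiplication by \<open>e21\<^sup>-\<^sup>s\<close> adds \<open>9 s\<close> to its lower entry.\<close>
      define w where "w = e21 [^]\<^bsub>SL2Z\<^esub> (- s) \<otimes>\<^bsub>SL2Z\<^esub> (c s [^]\<^bsub>SL2Z\<^esub> (- s))"
      have "w \<in> generate SL2Z (insert e21 S)"
        unfolding w_def using SL2Z.subgroup_int_pow_closed[OF K.subgroup_axioms] e by blast
      moreover have "w $ 1 $ 1 = - 9 \<and> w $ 2 $ 1 = 4 * s"
        by (simp add: w_def c_pow[OF s] e21_pow mult_entry)
      ultimately show ?thesis by blast
    qed
    moreover have "\<bar>a * (- 9) + b * (4 * s)\<bar> < \<bar>a\<bar>"
      using ab(4,5) ne unfolding s_def
      by (cases "a > 0"; cases "b > 0") (auto simp: sgn_if mult_pos_pos mult_neg_neg zero_less_mult_iff)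
    ultimately show "\<exists>g \<in> generate SL2Z (insert e21 S). \<bar>a * g $ 1 $ 1 + b * g $ 2 $ 1\<bar> < \<bar>a\<bar>"
      by metis
  qed (use SG in \<open>auto simp: S_def\<close>)
  also have "{e21 [^]\<^bsub>SL2Z\<^esub> (5 :: int)} \<union>
      {e21 [^]\<^bsub>SL2Z\<^esub> m \<otimes>\<^bsub>SL2Z\<^esub> s \<otimes>\<^bsub>SL2Z\<^esub> e21 [^]\<^bsub>SL2Z\<^esub> (- m) | (m :: int) s.
        0 \<le> m \<and> m \<le> 5 - 1 \<and> s \<in> S} = ?T"
  proof -
    have "e21 [^]\<^bsub>SL2Z\<^esub> m \<otimes>\<^bsub>SL2Z\<^esub> e12 [^]\<^bsub>SL2Z\<^esub> (2 * s) \<otimes>\<^bsub>SL2Z\<^esub> e21 [^]\<^bsub>SL2Z\<^esub> (5 :: int)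
             \<otimes>\<^bsub>SL2Z\<^esub> e12 [^]\<^bsub>SL2Z\<^esub> (- 2 * s) \<otimes>\<^bsub>SL2Z\<^esub> e21 [^]\<^bsub>SL2Z\<^esub> (- m)
        = e21 [^]\<^bsub>SL2Z\<^esub> m \<otimes>\<^bsub>SL2Z\<^esub> c s \<otimes>\<^bsub>SL2Z\<^esub> e21 [^]\<^bsub>SL2Z\<^esub> (- m)" for m s :: int
      using e12_in_SL2Z e21_in_SL2Z by (simp add: c_def SL2Z.m_assoc)
    then show ?thesis unfolding S_def by fastforce
  qed
  finally show ?thesis .
qed

text \<open>
  The gap is \<open>2 < \<bar>b / a\<bar> \<le> 3\<close>. The commutator of \<open>e21\<^sup>3\<^sup>s\<close> and \<open>e12\<^sup>2\<^sup>s\<close> has first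
  column \<open>(- 5, - 18 s)\<close>; left multiplication by \<open>e21\<^sup>-\<^sup>4\<^sup>s\<close> adds \<open>20 s\<close> to the lower entry and
  produces \<open>(- 5, 2 s)\<close>. For \<open>s = 1\<close>, \<open>\<bar>2 x - 5\<bar> < 1\<close> holds exactly for \<open>2 < x < 3\<close>; the case
  \<open>s = - 1\<close> covers the negative ratios.
\<close>

lemma Gamma2_6:
  "Gamma2 6 = generate SL2Z
        ({e21 [^]\<^bsub>SL2Z\<^esub> (6 :: int)} \<union>
         {e21 [^]\<^bsub>SL2Z\<^esub> m \<otimes>\<^bsub>SL2Z\<^esub> e12 [^]\<^bsub>SL2Z\<^esub> (6 :: int) \<otimes>\<^bsub>SL2Z\<^esub> e21 [^]\<^bsub>SL2Z\<^esub> (- m)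
           | m :: int. 0 \<le> m \<and> m \<le> 5} \<union>
         {e21 [^]\<^bsub>SL2Z\<^esub> m
             \<otimes>\<^bsub>SL2Z\<^esub> commutator SL2Z (e21 [^]\<^bsub>SL2Z\<^esub> (3 * s)) (e12 [^]\<^bsub>SL2Z\<^esub> (2 * s))
             \<otimes>\<^bsub>SL2Z\<^esub> e21 [^]\<^bsub>SL2Z\<^esub> (- m)
           | (m :: int) (s :: int). 0 \<le> m \<and> m \<le> 5 \<and> s \<in> {1, - 1}})"
    (is "_ = generate SL2Z ?T")
proof -
  define c where "c s = commutator SL2Z (e21 [^]\<^bsub>SL2Z\<^esub> (3 * s)) (e12 [^]\<^bsub>SL2Z\<^esub> (2 * s))" for s :: int
  define S where "S = insert (e12 [^]\<^bsub>SL2Z\<^esub> (6 :: int)) (c ` {1, - 1})"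
  have inv_pow: "inv\<^bsub>SL2Z\<^esub> (e12 [^]\<^bsub>SL2Z\<^esub> k) = e12 [^]\<^bsub>SL2Z\<^esub> (- k)"
    "inv\<^bsub>SL2Z\<^esub> (e21 [^]\<^bsub>SL2Z\<^esub> k) = e21 [^]\<^bsub>SL2Z\<^esub> (- k)" for k :: int
    by (simp_all add: SL2Z.int_pow_neg e12_in_SL2Z e21_in_SL2Z)
  have "c s = e21 [^]\<^bsub>SL2Z\<^esub> (3 * s) \<otimes>\<^bsub>SL2Z\<^esub> e12 [^]\<^bsub>SL2Z\<^esub> (2 * s)
      \<otimes>\<^bsub>SL2Z\<^esub> e21 [^]\<^bsub>SL2Z\<^esub> (- (3 * s)) \<otimes>\<^bsub>SL2Z\<^esub> e12 [^]\<^bsub>SL2Z\<^esub> (- (2 * s))" for s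
    by (simp only: c_def commutator_def inv_pow)
  then have c_eq: "c s = vector [vector [1 - 6 * s ^ 2, 12 * s ^ 3],
      vector [- 18 * s ^ 3, 1 + 6 * s ^ 2 + 36 * s ^ 4]]" for s
    by (simp only: e12_pow e21_pow eq_iff_entries mult_entry)
      (simp add: algebra_simps eval_nat_numeral)
  have cG: "c s \<in> Gamma2 6" for s
  proof -
    have "c s \<in> carrier SL2Z"
      by (simp add: c_def commutator_def e12_in_SL2Z e21_in_SL2Z)
    moreover have "6 dvd 12 * s ^ 3" "6 dvd 18 * s ^ 3" "6 dvd 6 * s ^ 2 + 36 * s ^ 4"
      by (auto intro: dvd_add dvd_mult2)
    ultimately show ?thesis unfolding in_Gamma2_iff by (simp only: c_eq) simp
  qed
  have SG: "S \<subseteq> Gamma2 6"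
    using cG by (auto simp: S_def e12_pow_in_Gamma2_iff)
  then have Sc: "insert e21 S \<subseteq> carrier SL2Z" using e21_in_SL2Z by (auto simp: in_Gamma2_iff)
  interpret K: subgroup "generate SL2Z (insert e21 S)" SL2Z
    by (rule SL2Z.generate_is_subgroup[OF Sc])
  have "Gamma2 6 = generate SL2Z ({e21 [^]\<^bsub>SL2Z\<^esub> (6 :: int)} \<union>
      {e21 [^]\<^bsub>SL2Z\<^esub> m \<otimes>\<^bsub>SL2Z\<^esub> s \<otimes>\<^bsub>SL2Z\<^esub> e21 [^]\<^bsub>SL2Z\<^esub> (- m) | (m :: int) s.
        0 \<le> m \<and> m \<le> 6 - 1 \<and> s \<in> S})"
  proof (rule Gamma2_generators)
    fix a b :: int
    assume ab: "coprime a b" "6 dvd a - 1" "6 dvd b" "2 * \<bar>a\<bar> < \<bar>b\<bar>" "2 * \<bar>b\<bar> \<le> 6 * \<bar>a\<bar>"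
    \<comment> \<open>Ratio \<open>\<plusminus> 3\<close> with coprime entries forces \<open>b = \<plusminus> 3\<close>, which is not a multiple of \<open>6\<close>.\<close>
    have ne: "\<bar>b\<bar> \<noteq> 3 * \<bar>a\<bar>"
    proof
      assume eq: "\<bar>b\<bar> = 3 * \<bar>a\<bar>"
      then have "a dvd b" by (metis abs_dvd_iff dvd_abs_iff dvd_triv_right)
      then have "\<bar>a\<bar> = 1" using ab(1) by (metis coprime_absorb_left zdvd1_eq)
      then have "b = 3 \<or> b = - 3" using eq by linarith
      then show False using ab(3) by auto
    qed
    define s where "s = sgn (a * b)"
    have s: "s \<in> {1, - 1}" using ab unfolding s_def by (auto simp: sgn_if)
    have "\<exists>g \<in> generate SL2Z (insert e21 S). g $ 1 $ 1 = - 5 \<and> g $ 2 $ 1 = 2 * s"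
    proof -
      have e: "e21 \<in> generate SL2Z (insert e21 S)" "c s \<in> generate SL2Z (insert e21 S)"
        using s by (auto simp: S_def intro: generate.incl)
      define w where "w = e21 [^]\<^bsub>SL2Z\<^esub> (- 4 * s) \<otimes>\<^bsub>SL2Z\<^esub> c s"
      have "w \<in> generate SL2Z (insert e21 S)"
        unfolding w_def using SL2Z.subgroup_int_pow_closed[OF K.subgroup_axioms] e by blast
      moreover have "w $ 1 $ 1 = - 5 \<and> w $ 2 $ 1 = 2 * s"
        using s by (auto simp: w_def c_eq e21_pow mult_entry)
      ultimately show ?thesis by blast
    qed
    moreover have "\<bar>a * (- 5) + b * (2 * s)\<bar> < \<bar>a\<bar>"
      using ab(4,5) ne unfolding s_def
      by (cases "a > 0"; cases "b > 0") (auto simp: sgn_if zero_less_mult_iff)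
    ultimately show "\<exists>g \<in> generate SL2Z (insert e21 S). \<bar>a * g $ 1 $ 1 + b * g $ 2 $ 1\<bar> < \<bar>a\<bar>"
      by metis
  qed (use SG in \<open>auto simp: S_def\<close>)
  also have "{e21 [^]\<^bsub>SL2Z\<^esub> (6 :: int)} \<union>
      {e21 [^]\<^bsub>SL2Z\<^esub> m \<otimes>\<^bsub>SL2Z\<^esub> s \<otimes>\<^bsub>SL2Z\<^esub> e21 [^]\<^bsub>SL2Z\<^esub> (- m) | (m :: int) s.
        0 \<le> m \<and> m \<le> 6 - 1 \<and> s \<in> S} = ?T"
    unfolding S_def c_def by fastforce
  finally show ?thesis .
qed

theorem theorem1p5:
  shows "(\<forall>d :: int. d = 3 \<or> d = 4 \<longrightarrow>
      Gamma2 d = generate SL2Z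
        ({e21 [^]\<^bsub>SL2Z\<^esub> d} \<union>
         {e21 [^]\<^bsub>SL2Z\<^esub> m \<otimes>\<^bsub>SL2Z\<^esub> e12 [^]\<^bsub>SL2Z\<^esub> d \<otimes>\<^bsub>SL2Z\<^esub> e21 [^]\<^bsub>SL2Z\<^esub> (- m)
           | m :: int. 0 \<le> m \<and> m \<le> d - 1}))
    \<and> Gamma2 5 = generate SL2Z
        ({e21 [^]\<^bsub>SL2Z\<^esub> (5 :: int)} \<union>
         {e21 [^]\<^bsub>SL2Z\<^esub> m \<otimes>\<^bsub>SL2Z\<^esub> e12 [^]\<^bsub>SL2Z\<^esub> (5 :: int) \<otimes>\<^bsub>SL2Z\<^esub> e21 [^]\<^bsub>SL2Z\<^esub> (- m)
           | m :: int. 0 \<le> m \<and> m \<le> 4} \<union>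
         {e21 [^]\<^bsub>SL2Z\<^esub> m \<otimes>\<^bsub>SL2Z\<^esub> e12 [^]\<^bsub>SL2Z\<^esub> (2 * s) \<otimes>\<^bsub>SL2Z\<^esub> e21 [^]\<^bsub>SL2Z\<^esub> (5 :: int)
             \<otimes>\<^bsub>SL2Z\<^esub> e12 [^]\<^bsub>SL2Z\<^esub> (- 2 * s) \<otimes>\<^bsub>SL2Z\<^esub> e21 [^]\<^bsub>SL2Z\<^esub> (- m)
           | (m :: int) (s :: int). 0 \<le> m \<and> m \<le> 4 \<and> s \<in> {1, - 1}})
    \<and> Gamma2 6 = generate SL2Z
        ({e21 [^]\<^bsub>SL2Z\<^esub> (6 :: int)} \<union>
         {e21 [^]\<^bsub>SL2Z\<^esub> m \<otimes>\<^bsub>SL2Z\<^esub> e12 [^]\<^bsub>SL2Z\<^esub> (6 :: int) \<otimes>\<^bsub>SL2Z\<^esub> e21 [^]\<^bsub>SL2Z\<^esub> (- m)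
           | m :: int. 0 \<le> m \<and> m \<le> 5} \<union>
         {e21 [^]\<^bsub>SL2Z\<^esub> m
             \<otimes>\<^bsub>SL2Z\<^esub> commutator SL2Z (e21 [^]\<^bsub>SL2Z\<^esub> (3 * s)) (e12 [^]\<^bsub>SL2Z\<^esub> (2 * s))
             \<otimes>\<^bsub>SL2Z\<^esub> e21 [^]\<^bsub>SL2Z\<^esub> (- m)
           | (m :: int) (s :: int). 0 \<le> m \<and> m \<le> 5 \<and> s \<in> {1, - 1}})"
  using Gamma2_3_4 Gamma2_5 Gamma2_6 by blast

end
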